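(* Let $k$ be an algebraically closed field of characteristic $p>0$ and let $R$ be a one dimensional finitely generated $\mathbb{N}$-graded $k$-algebra which is a domain. Let $I$ be a homogeneous ideal of $R$ of finite co-length. Let $h$ be the smallest integer such that $I$ contains a non-zero homogeneous element of degree $h$. Then $$F(R,R,I)(y)=e_R\left(\frac{1-e^{-ihy}}{iy}\right)$$ for all complex $y$ (with the right side extended analytically to $y=0$), where $e_R$ is the Hilbert-Samuel multiplicity of $R$.
   Context: A finitely generated $\mathbb{N}$-graded $k$-algebra is an $\mathbb{N}$-graded commutative ring with degree zero piece $k$, finitely generated over $k$. $I$ has finite co-length if $R/I$ has finite length. With $d=\dim R=1$, $e_R=d!\lim_{n\to\infty}\frac{1}{n^d}\sum_{j\le n}\lambda(R_j)$. $I^{[p^n]}$ is the ideal generated by $p^n$-th powers of elements of $I$; $\lambda$ is length over $k$; $(\cdot)_j$ is the degree $j$ piece; $i$ is a fixed square root of $-1$. The Frobenius-Poincaré function is the entire function $$F(R,R,I)(y)=\lim_{n\to\infty}\left(\frac{1}{p^n}\right)^{\dim R}\sum_{j\in\mathbb{Z}}\lambda\left(\left(\frac{R}{I^{[p^n]}}\right)_j\right)e^{-iyj/p^n},$$ where the limit exists for all $y\in\mathbb{C}$. *)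

theory Defs
  imports
    "HOL-Computational_Algebra.Computational_Algebra"
    "HOL-Library.Extended_Nat"
    "HOL-Complex_Analysis.Complex_Analysis"
begin

text \<open>
  Ideals of a commutative ring are the submodules of the ring over itself; the library
  notions \<open>module.subspace\<close> and \<open>module.span\<close> do not require scalars in a field.
\<close>

abbreviation is_ideal :: "'r::comm_ring_1 set \<Rightarrow> bool" where
  "is_ideal \<equiv> module.subspace (*)"

abbreviation ideal_generated_by :: "'r::comm_ring_1 set \<Rightarrow> 'r set" where
  "ideal_generated_by \<equiv> module.span (*)"

definition is_prime_ideal :: "'r::comm_ring_1 set \<Rightarrow> bool" where
  "is_prime_ideal P \<longleftrightarrow>
     is_ideal P \<and> P \<noteq> UNIV \<and> (\<forall>x y. x * y \<in> P \<longrightarrow> x \<in> P \<or> y \<in> P)"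

definition krull_dim :: "'r::comm_ring_1 itself \<Rightarrow> enat" where
  "krull_dim _ = Sup {enat n | n. \<exists>P :: nat \<Rightarrow> 'r set.
     (\<forall>i\<le>n. is_prime_ideal (P i)) \<and> (\<forall>i<n. P i \<subset> P (Suc i))}"


section \<open>Graded algebras\<close>

locale algebra_over_field = vector_space act
  for act :: "'k::field \<Rightarrow> 'r::comm_ring_1 \<Rightarrow> 'r" +
  assumes act_mult: "act c (x * y) = act c x * y"

definition is_subalgebra :: "('k::field \<Rightarrow> 'r::comm_ring_1 \<Rightarrow> 'r) \<Rightarrow> 'r set \<Rightarrow> bool" where
  "is_subalgebra act A \<longleftrightarrow>
     module.subspace act A \<and> 1 \<in> A \<and> (\<forall>x\<in>A. \<forall>y\<in>A. x * y \<in> A)"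

definition finitely_generated_algebra :: "('k::field \<Rightarrow> 'r::comm_ring_1 \<Rightarrow> 'r) \<Rightarrow> bool" where
  "finitely_generated_algebra act \<longleftrightarrow>
     (\<exists>S. finite S \<and> (\<forall>A. is_subalgebra act A \<and> S \<subseteq> A \<longrightarrow> A = UNIV))"

text \<open>
  \<open>G n\<close> is the homogeneous piece of degree \<open>n\<close>. Since \<open>1 \<noteq> 0\<close> in the ring, the structure
  map is injective, so the axiom \<open>degree_zero\<close> says that it identifies \<open>k\<close> with \<open>G 0\<close>.
\<close>

locale nat_graded_algebra = algebra_over_field act
  for act :: "'k::field \<Rightarrow> 'r::comm_ring_1 \<Rightarrow> 'r" +
  fixes G :: "nat \<Rightarrow> 'r set"
  assumes piece_subspace: "subspace (G n)"
    and piece_mult: "x \<in> G m \<Longrightarrow> y \<in> G n \<Longrightarrow> x * y \<in> G (m + n)"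
    and direct_sum:
      "\<exists>!f. (\<forall>n. f n \<in> G n) \<and> finite {n. f n \<noteq> 0} \<and> x = (\<Sum>n | f n \<noteq> 0. f n)"
    and degree_zero: "G 0 = range (\<lambda>c. act c 1)"

definition is_homogeneous_ideal :: "(nat \<Rightarrow> 'r::comm_ring_1 set) \<Rightarrow> 'r set \<Rightarrow> bool" where
  "is_homogeneous_ideal G I \<longleftrightarrow> (\<exists>S \<subseteq> (\<Union>n. G n). I = ideal_generated_by S)"


section \<open>Length of modules\<close>

text \<open>
  A module is given here by its carrier and its operations, so that the length can be taken
  both of a graded piece of the ring and of a graded piece of a quotient ring, whose elements
  are cosets. Closure under negation follows from closure under scalar multiplication.
\<close>

definition closed_submodule ::
    "('m \<Rightarrow> 'm \<Rightarrow> 'm) \<Rightarrow> 'm \<Rightarrow> ('a \<Rightarrow> 'm \<Rightarrow> 'm) \<Rightarrow> 'm set \<Rightarrow> bool" where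
  "closed_submodule add zero act N \<longleftrightarrow>
     zero \<in> N \<and> (\<forall>x\<in>N. \<forall>y\<in>N. add x y \<in> N) \<and> (\<forall>c. \<forall>x\<in>N. act c x \<in> N)"

definition module_length ::
    "('m \<Rightarrow> 'm \<Rightarrow> 'm) \<Rightarrow> 'm \<Rightarrow> ('a \<Rightarrow> 'm \<Rightarrow> 'm) \<Rightarrow> 'm set \<Rightarrow> enat" where
  "module_length add zero act M = Sup {enat n | n. \<exists>C :: nat \<Rightarrow> 'm set.
     (\<forall>i\<le>n. closed_submodule add zero act (C i) \<and> C i \<subseteq> M) \<and> (\<forall>i<n. C i \<subset> C (Suc i))}"

definition ideal_coset :: "'r::comm_ring_1 set \<Rightarrow> 'r \<Rightarrow> 'r set" where
  "ideal_coset J x = {x + j | j. j \<in> J}"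

definition ideal_coset_add :: "'r::comm_ring_1 set \<Rightarrow> 'r set \<Rightarrow> 'r set" where
  "ideal_coset_add A B = {a + b | a b. a \<in> A \<and> b \<in> B}"

text \<open>The summand \<open>j\<close> is needed: elementwise multiplication by \<open>0\<close> would give \<open>{0}\<close>, not \<open>J\<close>.\<close>

definition ideal_coset_act ::
    "('a \<Rightarrow> 'r \<Rightarrow> 'r) \<Rightarrow> 'r::comm_ring_1 set \<Rightarrow> 'a \<Rightarrow> 'r set \<Rightarrow> 'r set" where
  "ideal_coset_act act J c A = {act c a + j | a j. a \<in> A \<and> j \<in> J}"

text \<open>
  The length of the image of \<open>M\<close> in \<open>R/J\<close>, over the scalars acting through \<open>act\<close>. For
  homogeneous \<open>J\<close>, the piece of degree \<open>j\<close> of \<open>R/J\<close> is the image of \<open>G j\<close>.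
\<close>

definition quotient_length ::
    "('a \<Rightarrow> 'r \<Rightarrow> 'r) \<Rightarrow> 'r::comm_ring_1 set \<Rightarrow> 'r set \<Rightarrow> enat" where
  "quotient_length act J M = module_length ideal_coset_add J (ideal_coset_act act J) (ideal_coset J ` M)"

definition has_finite_colength :: "'r::comm_ring_1 set \<Rightarrow> bool" where
  "has_finite_colength I \<longleftrightarrow> quotient_length (*) I UNIV < \<infinity>"


section \<open>Hilbert-Samuel multiplicity and Frobenius-Poincare function\<close>

definition hilbert_samuel_multiplicity ::
    "('k::field \<Rightarrow> 'r::comm_ring_1 \<Rightarrow> 'r) \<Rightarrow> (nat \<Rightarrow> 'r set) \<Rightarrow> real" where
  "hilbert_samuel_multiplicity act G =
     (let d = the_enat (krull_dim TYPE('r)) in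
        fact d * lim (\<lambda>n. 1 / real n ^ d *
          (\<Sum>j\<le>n. real (the_enat (module_length (+) 0 act (G j))))))"

definition frobenius_power :: "'r::comm_ring_1 set \<Rightarrow> nat \<Rightarrow> 'r set" where
  "frobenius_power I q = ideal_generated_by {x ^ q | x. x \<in> I}"

text \<open>
  The sum over all integer degrees is a sum over \<open>nat\<close>, as the pieces of negative degree of
  an \<open>\<nat>\<close>-graded ring are \<open>0\<close>.
\<close>

definition frobenius_poincare ::
    "('k::field \<Rightarrow> 'r::comm_ring_1 \<Rightarrow> 'r) \<Rightarrow> (nat \<Rightarrow> 'r set) \<Rightarrow> 'r set \<Rightarrow> complex \<Rightarrow> complex" where
  "frobenius_poincare act G I y =
     (let p = CHAR('k); d = the_enat (krull_dim TYPE('r)) in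
        lim (\<lambda>n. (1 / of_nat (p ^ n)) ^ d *
          (\<Sum>\<^sub>\<infinity>j::nat. of_nat (the_enat (quotient_length act (frobenius_power I (p ^ n)) (G j))) *
             exp (- \<i> * y * of_nat j / of_nat (p ^ n)))))"

end

theory Submission
  imports Defs "HOL-Real_Asymp.Real_Asymp"
begin

text \<open>
  The key point is that every graded piece \<open>R\<^sub>n\<close> of \<open>R\<close> is at most one-dimensional over \<open>k\<close>. In
  geometric terms, \<open>Proj R\<close> is an integral projective scheme of dimension zero over an
  algebraically closed field, hence a single point. The proof given here is elementary. Fix a nonzero
  \<open>u\<close> of degree \<open>n > 0\<close>. Since \<open>R\<close> has dimension one, no prime lies strictly between zero
  and the irrelevant ideal, so every homogeneous element of positive degree has a power divisible
  by \<open>u\<close> (\<open>homogeneous_power_in_principal_ideal\<close>). As \<open>R\<close> is finitely generated, it is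
  therefore spanned modulo \<open>u\<close> by a finite set, whose size bounds the dimensions of all the
  pieces (\<open>finite_homogeneous_spanning_set_modulo\<close>, \<open>piece_spanned_by_bounded_set\<close>). If some \<open>v\<close> in
  \<open>R\<^sub>n\<close> were not proportional to \<open>u\<close>, then the monomials of degree \<open>N\<close> in \<open>u\<close> and \<open>v\<close> would be
  independent, because binary forms over \<open>k\<close> split into linear factors; for large \<open>N\<close> this exceeds
  the bound (\<open>piece_proportional\<close>).

  The degrees \<open>n\<close> with \<open>R\<^sub>n \<noteq> 0\<close> form a submonoid of the natural numbers. If \<open>g\<close> is their gcd, then
  all of them are multiples of \<open>g\<close>, and every large multiple of \<open>g\<close> is among them. Hence
  \<open>e\<^sub>R = 1 / g\<close>. For a power \<open>q\<close> of \<open>p\<close>, the ideal \<open>I\<^bsup>[q]\<^esup>\<close> vanishes in degrees below \<open>q h\<close>, and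
  it contains the line \<open>R\<^sub>j\<close> as soon as \<open>j \<ge> q h\<close> and the piece of degree \<open>j - q h\<close> is nonzero, as
  one sees by multiplying this piece with \<open>x\<^sup>q\<close> for a nonzero \<open>x \<in> I\<close> of degree \<open>h\<close>. So, apart from
  a number of degrees that is bounded independently of \<open>q\<close>, the length of the degree \<open>j\<close> piece
  of \<open>R / I\<^bsup>[q]\<^esup>\<close> is one if \<open>g\<close> divides \<open>j\<close> and \<open>j < q h\<close>, and zero otherwise. After division by
  \<open>q\<close> the exceptional degrees do not contribute to the limit, and the others contribute
  Riemann sums for the integral of \<open>exp (- \<i> y t) / g\<close> over \<open>0 \<le> t \<le> h\<close>, which are geometric
  sums (\<open>truncated_multiples_limit\<close>).
\<close>

interpretation ideal: module "(*) :: 'r::comm_ring_1 \<Rightarrow> 'r \<Rightarrow> 'r"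
  by unfold_locales (simp_all add: algebra_simps)

text \<open>For multiplication this rule is associativity read backwards, so it loops with the ring rules.\<close>
declare ideal.scale_scale [simp del]

section \<open>Homogeneous components\<close>

context algebra_over_field
begin

lemma act_mult_right: "act c (x * y) = x * act c y"
  using act_mult[of c y x] by (simp add: mult.commute)

lemma act_eq_mult: "act c x = act c 1 * x"
  using act_mult[of c 1 x] by simp

lemma ideal_act_closed:
  assumes "is_ideal J" "x \<in> J"
  shows "act c x \<in> J"
  using ideal.subspace_scale[OF assms, of "act c 1"] act_mult[of c 1 x] by simp

end

context nat_graded_algebra
begin

definition component :: "nat \<Rightarrow> 'r \<Rightarrow> 'r" where
  "component n x =
     (THE f. (\<forall>n. f n \<in> G n) \<and> finite {n. f n \<noteq> 0} \<and> x = (\<Sum>n | f n \<noteq> 0. f n)) n"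

lemma component_decomposition:
  "(\<forall>n. component n x \<in> G n) \<and> finite {n. component n x \<noteq> 0} \<and>
   x = (\<Sum>n | component n x \<noteq> 0. component n x)"
  unfolding component_def by (rule theI'[OF direct_sum])

lemma component_in_piece: "component n x \<in> G n"
  and finite_component_support: "finite {n. component n x \<noteq> 0}"
  using component_decomposition[of x] by blast+

lemma sum_components: "(\<Sum>n | component n x \<noteq> 0. component n x) = x"
  by (rule component_decomposition[THEN conjunct2, THEN conjunct2, symmetric])

lemma component_eqI:
  assumes "\<And>n. f n \<in> G n" "finite A" "\<And>n. n \<notin> A \<Longrightarrow> f n = 0" "x = (\<Sum>n\<in>A. f n)"
  shows "component n x = f n"
proof -
  have supp: "{n. f n \<noteq> 0} \<subseteq> A"
    using assms(3) by blast
  have "x = (\<Sum>n | f n \<noteq> 0. f n)"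
    unfolding assms(4) by (rule sum.mono_neutral_right) (use assms(2) supp in auto)
  then have "(\<forall>n. f n \<in> G n) \<and> finite {n. f n \<noteq> 0} \<and> x = (\<Sum>n | f n \<noteq> 0. f n)"
    using assms(1,2) supp finite_subset by blast
  with direct_sum[of x] component_decomposition[of x] have "(\<lambda>n. component n x) = f"
    by (elim ex1E) metis
  then show ?thesis
    by (rule fun_cong)
qed

lemma sum_components_superset:
  assumes "finite A" "{n. component n x \<noteq> 0} \<subseteq> A"
  shows "(\<Sum>n\<in>A. component n x) = x"
  using sum.mono_neutral_left[OF assms, of "\<lambda>n. component n x"] by (simp add: sum_components)

lemma component_homogeneous:
  assumes "x \<in> G m"
  shows "component n x = (if n = m then x else 0)"
  by (rule component_eqI[where A = "{m}"]) (use assms piece_subspace in \<open>auto simp: subspace_0\<close>)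

lemma component_add: "component n (x + y) = component n x + component n y"
proof -
  let ?A = "{n. component n x \<noteq> 0} \<union> {n. component n y \<noteq> 0}"
  have fin: "finite ?A"
    by (simp add: finite_component_support)
  then have "(\<Sum>n\<in>?A. component n x) = x" "(\<Sum>n\<in>?A. component n y) = y"
    by (intro sum_components_superset; auto)+
  then have "x + y = (\<Sum>n\<in>?A. component n x + component n y)"
    by (simp add: sum.distrib)
  with fin show ?thesis
    by (intro component_eqI[where A = ?A])
       (auto simp: component_in_piece piece_subspace subspace_add)
qed

lemma component_act: "component n (act c x) = act c (component n x)"
proof -
  have "act c x = (\<Sum>n | component n x \<noteq> 0. act c (component n x))"
    by (simp add: scale_sum_right[symmetric] sum_components)
  then show ?thesis
    by (intro component_eqI[where A = "{n. component n x \<noteq> 0}"])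
       (auto simp: finite_component_support component_in_piece piece_subspace subspace_scale)
qed

lemma component_0 [simp]: "component n 0 = 0"
  using component_act[of n 0 0] by simp

lemma component_sum: "component n (sum f A) = (\<Sum>x\<in>A. component n (f x))"
  by (induction A rule: infinite_finite_induct) (simp_all add: component_add)

lemma component_mult_homogeneous:
  assumes "x \<in> G m"
  shows "component n (x * y) = (if m \<le> n then x * component (n - m) y else 0)"
proof -
  let ?f = "\<lambda>n. if m \<le> n then x * component (n - m) y else 0"
  let ?B = "{n. component n y \<noteq> 0}"
  have "?f n \<in> G n" for n
    using piece_mult[OF assms component_in_piece[of "n - m" y]] subspace_0[OF piece_subspace, of n]
    by (cases "m \<le> n") simp_all
  moreover have "?f n = 0" if "n \<notin> (+) m ` ?B" for n
  proof (cases "m \<le> n")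
    case True
    then have "n = m + (n - m)" by simp
    with that have "n - m \<notin> ?B" by blast
    then show ?thesis by simp
  qed simp
  moreover have "x * y = (\<Sum>n\<in>(+) m ` ?B. ?f n)"
    by (subst sum.reindex) (auto simp: inj_on_def sum_distrib_left[symmetric] sum_components)
  ultimately show ?thesis
    by (intro component_eqI[where A = "(+) m ` ?B"]) (auto simp: finite_component_support)
qed

lemma component_mult: "component n (x * y) = (\<Sum>i\<le>n. component i x * component (n - i) y)"
proof -
  let ?A = "{n. component n x \<noteq> 0} \<union> {..n}"
  have fin: "finite ?A"
    by (simp add: finite_component_support)
  have "component n (x * y) = component n ((\<Sum>i\<in>?A. component i x) * y)"
    by (subst sum_components_superset) (use fin in auto)
  also have "\<dots> = (\<Sum>i\<in>?A. if i \<le> n then component i x * component (n - i) y else 0)"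
    by (simp add: sum_distrib_right component_sum component_mult_homogeneous[OF component_in_piece])
  also have "\<dots> = (\<Sum>i\<le>n. component i x * component (n - i) y)"
    by (rule sum.mono_neutral_cong_right) (use fin in auto)
  finally show ?thesis .
qed

lemma one_in_piece_0: "1 \<in> G 0"
  unfolding degree_zero by (metis rangeI scale_one)

lemma power_in_piece: "x \<in> G m \<Longrightarrow> x ^ j \<in> G (m * j)"
  by (induction j) (auto simp: one_in_piece_0 dest: piece_mult)

lemma piece_0_unit:
  assumes "x \<in> G 0" "x \<noteq> 0"
  obtains c where "act c x = 1"
proof -
  obtain a where a: "x = act a 1"
    using assms(1) degree_zero by blast
  with assms(2) have "a \<noteq> 0" by auto
  with a have "act (inverse a) x = 1" by simp
  then show thesis by (rule that)
qed

text \<open>\<open>tail m\<close> is the ideal \<open>\<Oplus>\<^bsub>n \<ge> m\<^esub> R\<^sub>n\<close>; in particular \<open>tail 1\<close> is the irrelevant ideal.\<close>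

definition tail :: "nat \<Rightarrow> 'r set" where
  "tail m = {x. \<forall>n<m. component n x = 0}"

lemma is_ideal_tail: "is_ideal (tail m)"
  by (rule ideal.subspaceI) (auto simp: tail_def component_add component_mult)

lemma piece_subset_tail: "m \<le> n \<Longrightarrow> G n \<subseteq> tail m"
  by (auto simp: tail_def component_homogeneous)

lemma tail_mult:
  assumes "x \<in> tail a" "y \<in> tail b"
  shows "x * y \<in> tail (a + b)"
proof -
  have "component i x * component (n - i) y = 0" if "n < a + b" "i \<le> n" for n i
    using assms that by (cases "i < a") (auto simp: tail_def)
  then show ?thesis
    by (simp add: tail_def component_mult)
qed

lemma tail_power: "x \<in> tail a \<Longrightarrow> x ^ q \<in> tail (q * a)"
  by (induction q) (auto simp: tail_def[of 0] dest: tail_mult)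

lemma frobenius_power_subset_tail:
  assumes "I \<subseteq> tail h"
  shows "frobenius_power I q \<subseteq> tail (q * h)"
  unfolding frobenius_power_def
  by (rule ideal.span_minimal[OF _ is_ideal_tail]) (use assms tail_power in auto)

end

section \<open>Prime ideals and dimension\<close>

text \<open>
  An ideal that is maximal among those containing \<open>J\<close> and missing \<open>W\<close> is prime: adjoining
  either of two elements \<open>x\<close>, \<open>y\<close> outside it produces an element of \<open>W\<close>, and if \<open>x * y\<close> were
  inside, the product of these two elements of \<open>W\<close> would be inside as well.
\<close>

lemma prime_ideal_avoiding:
  fixes J W :: "'r::comm_ring_1 set"
  assumes "is_ideal J" "J \<inter> W = {}" "1 \<in> W" and W: "\<And>a b. a \<in> W \<Longrightarrow> b \<in> W \<Longrightarrow> a * b \<in> W"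
  obtains P where "is_prime_ideal P" "J \<subseteq> P" "P \<inter> W = {}"
proof -
  let ?A = "{A. is_ideal A \<and> J \<subseteq> A \<and> A \<inter> W = {}}"
  have "\<exists>P\<in>?A. \<forall>X\<in>?A. P \<subseteq> X \<longrightarrow> X = P"
  proof (rule subset_Zorn_nonempty)
    show "?A \<noteq> {}" using assms by blast
    fix C assume C: "C \<noteq> {}" "subset.chain ?A C"
    then have sub: "C \<subseteq> ?A" and lin: "\<And>X Y. X \<in> C \<Longrightarrow> Y \<in> C \<Longrightarrow> X \<subseteq> Y \<or> Y \<subseteq> X"
      by (auto simp: subset_chain_def)
    have "is_ideal (\<Union>C)"
    proof (rule ideal.subspaceI)
      show "0 \<in> \<Union>C" using C(1) sub ideal.subspace_0 by blast
      show "x + y \<in> \<Union>C" if "x \<in> \<Union>C" "y \<in> \<Union>C" for x y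
      proof -
        from that obtain X Y where "X \<in> C" "x \<in> X" "Y \<in> C" "y \<in> Y"
          by (elim UnionE)
        then obtain Z where "Z \<in> C" "x \<in> Z" "y \<in> Z" using lin by blast
        then show ?thesis using sub ideal.subspace_add by blast
      qed
      show "c * x \<in> \<Union>C" if "x \<in> \<Union>C" for c x
        using that sub ideal.subspace_scale by blast
    qed
    then show "\<Union>C \<in> ?A" using C(1) sub by blast
  qed
  then obtain P where "P \<in> ?A" and maximal: "\<forall>X\<in>?A. P \<subseteq> X \<longrightarrow> X = P"
    by (elim bexE)
  then have P: "is_ideal P" "J \<subseteq> P" "P \<inter> W = {}"
    by simp_all
  have meets: "\<exists>w\<in>W. \<exists>r. w - x * r \<in> P" if "x \<notin> P" for x
  proof -
    let ?X = "{w. \<exists>r. w - x * r \<in> P}"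
    have "is_ideal ?X"
    proof (rule ideal.subspaceI)
      show "0 \<in> ?X"
        using ideal.subspace_0[OF P(1)] by (auto intro: exI[of _ 0])
      show "u + v \<in> ?X" if uv: "u \<in> ?X" "v \<in> ?X" for u v
      proof -
        from uv obtain r s where "u - x * r \<in> P" "v - x * s \<in> P"
          by auto
        from ideal.subspace_add[OF P(1) this] have "u + v - x * (r + s) \<in> P"
          by (simp add: algebra_simps)
        then show ?thesis by blast
      qed
      show "c * u \<in> ?X" if u: "u \<in> ?X" for c u
      proof -
        from u obtain r where "u - x * r \<in> P"
          by auto
        from ideal.subspace_scale[OF P(1) this, of c] have "c * u - x * (c * r) \<in> P"
          by (simp add: algebra_simps)
        then show ?thesis by blast
      qed
    qed
    moreover have "P \<subseteq> ?X"
      by (auto intro: exI[of _ 0])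
    moreover have "x \<in> ?X"
      using ideal.subspace_0[OF P(1)] by (auto intro: exI[of _ 1])
    ultimately have "?X \<inter> W \<noteq> {}"
      using bspec[OF maximal, of ?X] P(2) that by auto
    then show ?thesis by blast
  qed
  have "x \<in> P \<or> y \<in> P" if xy: "x * y \<in> P" for x y
  proof (rule ccontr)
    assume "\<not> ?thesis"
    then have "x \<notin> P" "y \<notin> P" by simp_all
    then obtain v r w s where vw: "v \<in> W" "v - x * r \<in> P" "w \<in> W" "w - y * s \<in> P"
      using meets by meson
    have "v * w = w * (v - x * r) + (x * r) * (w - y * s) + (r * s) * (x * y)"
      by (simp add: algebra_simps)
    also have "\<dots> \<in> P"
      by (intro ideal.subspace_add[OF P(1)] ideal.subspace_scale[OF P(1)] vw xy)
    finally show False using W[OF vw(1,3)] P(3) by blast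
  qed
  with P assms(3) have "is_prime_ideal P"
    unfolding is_prime_ideal_def by blast
  with P show thesis by (intro that)
qed

lemma no_long_prime_chain:
  fixes P Q M :: "'r::comm_ring_1 set"
  assumes "krull_dim TYPE('r) = 1"
    and "is_prime_ideal P" "is_prime_ideal Q" "is_prime_ideal M" "P \<subset> Q" "Q \<subset> M"
  shows False
proof -
  let ?C = "\<lambda>i::nat. if i = 0 then P else if i = 1 then Q else M"
  have "enat 2 \<le> krull_dim TYPE('r)"
    unfolding krull_dim_def
    by (rule Sup_upper, rule CollectI, rule exI[of _ 2], intro conjI refl exI[of _ ?C])
       (use assms in \<open>simp_all add: less_Suc_eq numeral_2_eq_2\<close>)
  with assms(1) show False
    by (simp add: one_enat_def)
qed

lemma is_prime_ideal_zero: "is_prime_ideal {0 :: 'r::idom}"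
proof -
  have "1 \<notin> {0 :: 'r}" by simp
  then have "{0 :: 'r} \<noteq> UNIV" by blast
  then show ?thesis
    unfolding is_prime_ideal_def by simp
qed

lemma krull_dim_field:
  assumes "\<And>x::'r::comm_ring_1. x \<noteq> 0 \<Longrightarrow> \<exists>y. x * y = 1"
  shows "krull_dim TYPE('r) = 0"
proof -
  have prime: "P = {0}" if P: "is_prime_ideal P" for P :: "'r set"
  proof (rule ccontr)
    assume "P \<noteq> {0}"
    with P obtain x y where "x \<in> P" "x * y = 1"
      using assms ideal.subspace_0[of P] unfolding is_prime_ideal_def by blast
    with P have "c * (y * x) \<in> P" for c
      unfolding is_prime_ideal_def by (auto intro!: ideal.subspace_scale)
    with \<open>x * y = 1\<close> P show False
      by (auto simp: is_prime_ideal_def mult.commute)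
  qed
  have "n = 0" if "\<forall>i\<le>n. is_prime_ideal (P i)" "\<forall>i<n. P i \<subset> P (Suc i)"
    for n and P :: "nat \<Rightarrow> 'r set"
  proof (rule ccontr)
    assume "n \<noteq> 0"
    with that have "P 0 \<subset> P 1" "P 0 = {0}" "P 1 = {0}"
      by (auto intro!: prime)
    then show False by simp
  qed
  then show ?thesis
    unfolding krull_dim_def
    by (intro antisym i0_lb Sup_least) (auto simp: zero_enat_def)
qed

section \<open>Graded pieces are at most one-dimensional\<close>

lemma (in algebra_over_field) span_mult_closed:
  assumes X: "\<And>x y. x \<in> X \<Longrightarrow> y \<in> X \<Longrightarrow> x * y \<in> X"
    and a: "a \<in> span X" and b: "b \<in> span X"
  shows "a * b \<in> span X"
proof -
  have 1: "x * b \<in> span X" if "x \<in> X" for x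
    using b
  proof (induction rule: span_induct)
    case base
    show ?case
      by (rule subspaceI)
         (auto simp: distrib_left act_mult_right[symmetric] span_zero span_add span_scale)
  next
    case (step y)
    with X that show ?case by (simp add: span_base)
  qed
  from a show ?thesis
  proof (induction rule: span_induct)
    case base
    show ?case
      by (rule subspaceI)
         (auto simp: distrib_right act_mult[symmetric] span_zero span_add span_scale)
  next
    case (step x)
    then show ?case by (rule 1)
  qed
qed

locale graded_domain = nat_graded_algebra act G
  for act :: "'k::alg_closed_field \<Rightarrow> 'r::idom \<Rightarrow> 'r" and G
begin

lemma is_prime_ideal_irrelevant: "is_prime_ideal (tail 1)"
proof -
  have "1 \<notin> tail 1"
    by (simp add: tail_def component_homogeneous[OF one_in_piece_0])
  then have "tail 1 \<noteq> UNIV" by blast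
  moreover have "x \<in> tail 1 \<or> y \<in> tail 1" if "x * y \<in> tail 1" for x y
    using that by (simp add: tail_def component_mult)
  ultimately show ?thesis
    using is_ideal_tail by (auto simp: is_prime_ideal_def)
qed

lemma exists_positive_piece:
  assumes "krull_dim TYPE('r) = 1"
  obtains n where "n > 0" "G n \<noteq> {0}"
proof -
  have "\<exists>n>0. G n \<noteq> {0}"
  proof (rule ccontr)
    assume "\<not> ?thesis"
    then have "component n x = 0" if "n > 0" for n x
      using component_in_piece[of n x] that by blast
    then have "{n. component n x \<noteq> 0} \<subseteq> {0}" for x
      by auto
    then have "x = component 0 x" for x
      using sum_components_superset[of "{0}" x] by simp
    then have "x \<in> G 0" for x
      using component_in_piece[of 0 x] by simp
    then have "\<exists>y. x * y = 1" if "x \<noteq> 0" for x :: 'r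
      using piece_0_unit[of x] that by (metis act_eq_mult mult.commute)
    then show False
      using krull_dim_field[where 'r = 'r] assms by simp
  qed
  with that show thesis by blast
qed

text \<open>
  This is where the dimension enters. If no power of \<open>z\<close> were divisible by \<open>x\<close>, the multiplicative
  set of all \<open>z ^ N * u\<close> with \<open>u\<close> outside the irrelevant ideal \<open>M\<close> would miss the principal ideal
  of \<open>x\<close>: in an equation \<open>x * r = z ^ N * u\<close> the component of degree \<open>m * N\<close> on the right is \<open>z ^ N\<close> times
  a nonzero scalar, while the one on the left is divisible by \<open>x\<close>. A prime \<open>P\<close> containing \<open>x\<close> and missing this set gives a chain
  \<open>{0} \<subset> P \<subset> M\<close>, strict because \<open>x \<in> P\<close> and \<open>z \<in> M - P\<close>.
\<close>

lemma homogeneous_power_in_principal_ideal: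
  assumes dim: "krull_dim TYPE('r) = 1"
    and x: "x \<in> G n" "x \<noteq> 0" and z: "z \<in> G m" "m > 0"
  shows "\<exists>N. x dvd z ^ N"
proof (rule ccontr)
  assume not_dvd: "\<not> ?thesis"
  let ?J = "range ((*) x)" and ?W = "{z ^ N * u | N u. u \<notin> tail 1}"
  have prime: "is_prime_ideal (tail 1)"
    by (rule is_prime_ideal_irrelevant)
  have one: "1 \<notin> tail 1"
    by (simp add: tail_def component_homogeneous[OF one_in_piece_0])
  have W1: "u \<in> ?W" if "u \<notin> tail 1" for u
    using that by (auto intro: exI[of _ 0])
  have zW: "z \<in> ?W"
    using one by (auto intro!: exI[of _ 1])
  have "is_ideal ?J"
    by (rule ideal.subspaceI) (auto simp: image_iff distrib_left[symmetric] mult.left_commute)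
  moreover have "x * r \<noteq> z ^ N * u" if u: "u \<notin> tail 1" for r N u
  proof
    assume eq: "x * r = z ^ N * u"
    have "component (m * N) (x * r) = (if n \<le> m * N then x * component (m * N - n) r else 0)"
      by (rule component_mult_homogeneous[OF x(1)])
    then have "x dvd component (m * N) (x * r)" by simp
    also have "component (m * N) (x * r) = z ^ N * component 0 u"
      unfolding eq by (subst component_mult_homogeneous[OF power_in_piece[OF z(1)]]) simp
    finally obtain s where s: "z ^ N * component 0 u = x * s"
      by (elim dvdE)
    have "component 0 u \<noteq> 0"
      using u by (simp add: tail_def)
    then obtain c where c: "act c (component 0 u) = 1"
      using piece_0_unit component_in_piece by metis
    have "z ^ N = act c (z ^ N * component 0 u)"
      by (simp add: act_mult_right c)
    also have "\<dots> = x * act c s"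
      by (simp add: s act_mult_right)
    finally show False using not_dvd by (metis dvd_triv_left)
  qed
  then have "?J \<inter> ?W = {}" by blast
  moreover have "1 \<in> ?W" using W1[OF one] .
  moreover have "a * b \<in> ?W" if ab: "a \<in> ?W" "b \<in> ?W" for a b
  proof -
    obtain N u M v where "a = z ^ N * u" "b = z ^ M * v" "u \<notin> tail 1" "v \<notin> tail 1"
      using ab by blast
    then have "a * b = z ^ (N + M) * (u * v)" "u * v \<notin> tail 1"
      using prime by (auto simp: power_add is_prime_ideal_def)
    then show ?thesis by blast
  qed
  ultimately obtain P where P: "is_prime_ideal P" "?J \<subseteq> P" "P \<inter> ?W = {}"
    by (rule prime_ideal_avoiding)
  have "x \<in> P" using P(2) by (metis mult.right_neutral rangeI subsetD)
  have "{0} \<subset> P"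
    using \<open>x \<in> P\<close> x(2) P(1) ideal.subspace_0[of P] by (auto simp: is_prime_ideal_def)
  moreover have "P \<subset> tail 1"
  proof -
    have "P \<subseteq> tail 1" using P(3) W1 by blast
    moreover have "z \<in> tail 1" using piece_subset_tail[of 1 m] z by auto
    moreover have "z \<notin> P" using P(3) zW by blast
    ultimately show ?thesis by blast
  qed
  ultimately show False
    by (rule no_long_prime_chain[OF dim is_prime_ideal_zero P(1) prime])
qed

text \<open>
  The homogeneous components of positive degree of algebra generators are again generators, and
  each is nilpotent modulo \<open>x\<close>. Hence the monomials in them with bounded exponents
  span \<open>R\<close> modulo \<open>x\<close>.
\<close>

lemma finite_homogeneous_spanning_set_modulo:
  assumes dim: "krull_dim TYPE('r) = 1" and fg: "finitely_generated_algebra act"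
    and x: "x \<in> G n" "x \<noteq> 0"
  obtains F where "finite F" "F \<subseteq> (\<Union>d. G d)" "span (F \<union> range ((*) x)) = UNIV"
proof -
  obtain S where S: "finite S" and gen: "\<And>A. is_subalgebra act A \<Longrightarrow> S \<subseteq> A \<Longrightarrow> A = UNIV"
    using fg unfolding finitely_generated_algebra_def by blast
  (* Z: the positive-degree components of the generators; the components of degree 0 are scalars. *)
  define Z where "Z = (\<Union>s\<in>S. (\<lambda>m. component m s) ` {m. m > 0 \<and> component m s \<noteq> 0})"
  have "finite Z"
    unfolding Z_def using S finite_component_support by (auto intro!: finite_imageI)
  have Z_homogeneous: "\<exists>m>0. z \<in> G m" if "z \<in> Z" for z
    using that component_in_piece by (auto simp: Z_def)
  then have "\<exists>N. x dvd z ^ N" if "z \<in> Z" for z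
    using homogeneous_power_in_principal_ideal[OF dim x] that by blast
  then obtain N0 where N0: "\<And>z. z \<in> Z \<Longrightarrow> x dvd z ^ N0 z" by metis
  (* Any exponent bound of at least 2 keeps z itself among the monomials. *)
  define N where "N z = N0 z + 2" for z
  have N: "x dvd z ^ k" if "z \<in> Z" "N z \<le> k" for z k
    using N0[OF that(1)] le_imp_power_dvd[of "N0 z" k z] that(2) by (auto simp: N_def intro: dvd_trans)
  define mon where "mon e = (\<Prod>z\<in>Z. z ^ e z)" for e :: "'r \<Rightarrow> nat"
  define F where "F = mon ` (PiE Z (\<lambda>z. {..<N z}))"
  let ?J = "range ((*) x)"
  have "finite F"
    unfolding F_def using \<open>finite Z\<close> by (intro finite_imageI finite_PiE) auto
  have monF: "mon e \<in> F" if "\<And>z. z \<in> Z \<Longrightarrow> e z < N z" for e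
  proof -
    have "mon e = mon (restrict e Z)" by (simp add: mon_def)
    then show ?thesis unfolding F_def using that by auto
  qed
  have mult: "a * b \<in> F \<union> ?J" if "a \<in> F \<union> ?J" "b \<in> F \<union> ?J" for a b
  proof (cases "x dvd a * b")
    case True
    then show ?thesis by (auto simp: dvd_def)
  next
    case False
    then have "a \<notin> ?J" "b \<notin> ?J" by auto
    with that obtain e f where "a = mon e" "b = mon f"
      unfolding F_def by blast
    then have ab: "a * b = mon (\<lambda>z. e z + f z)"
      by (simp add: mon_def power_add prod.distrib)
    have "e z + f z < N z" if "z \<in> Z" for z
    proof (rule ccontr)
      assume "\<not> ?thesis"
      then have "x dvd z ^ (e z + f z)" using N that by simp
      also have "z ^ (e z + f z) dvd a * b"
        unfolding ab mon_def using \<open>finite Z\<close> that by (rule dvd_prodI)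
      finally show False using False by simp
    qed
    then have "a * b \<in> F" unfolding ab by (rule monF)
    then show ?thesis by blast
  qed
  have one: "1 \<in> F"
    using monF[of "\<lambda>_. 0"] by (simp add: mon_def N_def)
  have "z \<in> F" if "z \<in> Z" for z
  proof -
    have "mon (\<lambda>w. if w = z then 1 else 0) = (\<Prod>w\<in>Z. if w = z then w else 1)"
      unfolding mon_def by (rule prod.cong) auto
    also have "\<dots> = z"
      using that \<open>finite Z\<close> by simp
    finally have "mon (\<lambda>w. if w = z then 1 else 0) = z" .
    moreover have "mon (\<lambda>w. if w = z then 1 else 0) \<in> F"
      by (rule monF) (auto simp: N_def)
    ultimately show ?thesis by simp
  qed
  then have comp: "component m s \<in> span (F \<union> ?J)" if "s \<in> S" for m s
  proof (cases "m = 0")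
    case True
    then obtain c where "component m s = act c 1"
      using component_in_piece[of 0 s] degree_zero by auto
    then show ?thesis using one by (auto intro: span_scale span_base)
  next
    case False
    then have "component m s = 0 \<or> component m s \<in> Z"
      using that unfolding Z_def by blast
    then show ?thesis using \<open>\<And>z. z \<in> Z \<Longrightarrow> z \<in> F\<close> by (auto intro: span_zero span_base)
  qed
  have "S \<subseteq> span (F \<union> ?J)"
  proof
    fix s assume "s \<in> S"
    then have "(\<Sum>m | component m s \<noteq> 0. component m s) \<in> span (F \<union> ?J)"
      by (intro span_sum comp)
    then show "s \<in> span (F \<union> ?J)" by (simp add: sum_components)
  qed
  moreover have "is_subalgebra act (span (F \<union> ?J))"
    unfolding is_subalgebra_def using one span_mult_closed[OF mult] by (auto intro: span_base)
  ultimately have "span (F \<union> ?J) = UNIV" by (rule gen[rotated])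
  moreover have "F \<subseteq> (\<Union>d. G d)"
  proof -
    have "\<exists>d. (\<Prod>z\<in>Y. z ^ e z) \<in> G d" if "Y \<subseteq> Z" for e Y
      using finite_subset[OF that \<open>finite Z\<close>] that
    proof (induction Y rule: finite_induct)
      case empty
      show ?case using one_in_piece_0 by auto
    next
      case (insert z Y)
      then obtain d m where "(\<Prod>z\<in>Y. z ^ e z) \<in> G d" "z \<in> G m"
        using Z_homogeneous by blast
      then show ?case
        using insert.hyps piece_mult power_in_piece by (metis prod.insert)
    qed
    then show ?thesis unfolding F_def mon_def by blast
  qed
  ultimately show thesis using that \<open>finite F\<close> by blast
qed

text \<open>
  Writing an element of \<open>R\<close> modulo \<open>x\<close> as a combination of \<open>F\<close> and repeating this with the cofactor
  of \<open>x\<close>, whose degree has dropped by \<open>n\<close>, shows that \<open>G m\<close> is spanned by products \<open>f * x ^ i\<close> of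
  degree \<open>m\<close>. The degree determines \<open>i\<close> from \<open>f\<close>, so there are at most \<open>card F\<close> of them: the
  Hilbert function is bounded, independently of \<open>m\<close>.
\<close>

lemma piece_spanned_by_bounded_set:
  assumes F: "finite F" "F \<subseteq> (\<Union>d. G d)" "span (F \<union> range ((*) x)) = UNIV"
    and x: "x \<in> G n" "n > 0"
  obtains T where "finite T" "card T \<le> card F" "G m \<subseteq> span T"
proof -
  from F(2) obtain d where d: "\<And>f. f \<in> F \<Longrightarrow> f \<in> G (d f)"
    by (metis UN_E subsetD)
  (* The condition d f \<le> m matters: the subtraction m - d f is truncated. *)
  define B where "B m = (\<lambda>f. f * x ^ ((m - d f) div n)) ` {f \<in> F. d f \<le> m}" for m
  have shift: "x * b \<in> span (B m)" if b: "b \<in> span (B (m - n))" and "n \<le> m" for b m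
    using b
  proof (induction rule: span_induct)
    case base
    show ?case
      by (rule subspaceI)
         (auto simp: distrib_left act_mult_right[symmetric] span_zero span_add span_scale)
  next
    case (step b)
    then obtain f where f: "f \<in> F" "d f \<le> m - n" "b = f * x ^ ((m - n - d f) div n)"
      unfolding B_def by blast
    have "(m - d f) div n = Suc ((m - d f - n) div n)"
      using f(2) \<open>n > 0\<close> \<open>n \<le> m\<close> by (intro le_div_geq) auto
    then have "x * b = f * x ^ ((m - d f) div n)"
      using f(3) by (simp add: diff_commute[of m n] mult.left_commute del: diff_diff_left)
    moreover have "d f \<le> m" using f(2) by simp
    ultimately have "x * b \<in> B m" unfolding B_def using f(1) by blast
    then show ?case by (rule span_base)
  qed
  have span: "G m \<subseteq> span (B m)" for m
  proof (induction m rule: less_induct)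
    case (less m)
    have "component m a \<in> span (B m)" if "a \<in> span (F \<union> range ((*) x))" for a
      using that
    proof (induction rule: span_induct)
      case base
      show ?case
        by (rule subspaceI) (auto simp: component_add component_act span_zero span_add span_scale)
    next
      case (step a)
      then consider "a \<in> F" | r where "a = x * r" by blast
      then show ?case
      proof cases
        case 1
        show ?thesis
        proof (cases "m = d a")
          case True
          then have "d a \<le> m" by simp
          with 1 have "a * x ^ ((m - d a) div n) \<in> B m" unfolding B_def by blast
          with True show ?thesis
            by (simp add: component_homogeneous[OF d[OF 1]] span_base)
        next
          case False
          then show ?thesis by (simp add: component_homogeneous[OF d[OF 1]] span_zero)
        qed
      next
        case 2
        show ?thesis
        proof (cases "n \<le> m")
          case True
          then have "component (m - n) r \<in> span (B (m - n))"
            using less.IH[of "m - n"] \<open>n > 0\<close> component_in_piece by auto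
          with True show ?thesis
            by (simp add: 2 component_mult_homogeneous[OF x(1)] shift)
        qed (simp add: 2 component_mult_homogeneous[OF x(1)] span_zero)
      qed
    qed
    then have "component m a \<in> span (B m)" for a
      using F(3) by simp
    then show ?case
      using component_homogeneous by (metis subsetI)
  qed
  have "card (B m) \<le> card {f \<in> F. d f \<le> m}"
    unfolding B_def by (rule card_image_le) (use F(1) in simp)
  also have "\<dots> \<le> card F"
    by (rule card_mono) (use F(1) in auto)
  finally have "card (B m) \<le> card F" .
  moreover have "finite (B m)" unfolding B_def using F(1) by simp
  ultimately show thesis using that span by blast
qed

text \<open>
  Over an algebraically closed field a binary form is a product of linear forms, so if a nonzero
  form vanishes at \<open>(v, u)\<close> in a domain then one of its linear factors does. This factor is not \<open>u\<close>
  alone, because \<open>u \<noteq> 0\<close>.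
\<close>

lemma binary_form_root:
  assumes "f \<noteq> 0" "degree f \<le> d" "u \<noteq> 0"
    and "(\<Sum>i\<le>d. act (coeff f i) (v ^ i * u ^ (d - i))) = 0"
  shows "\<exists>c. v = act c u"
  using assms
proof (induction "degree f" arbitrary: f d)
  case 0
  then obtain a where f: "f = [:a:]" using degree_eq_zeroE by metis
  have "(\<Sum>i\<le>d. act (coeff f i) (v ^ i * u ^ (d - i))) =
      (\<Sum>i\<le>d. if i = 0 then act a (u ^ d) else 0)"
    by (rule sum.cong) (auto simp: f coeff_pCons split: nat.splits)
  with 0 f show ?case by simp
next
  case (Suc k)
  obtain c where "poly f c = 0"
    using alg_closed_imp_poly_has_root[of f] Suc.hyps(2) by auto
  then obtain g where g: "f = [:-c, 1:] * g"
    by (auto simp: poly_eq_0_iff_dvd)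
  with Suc.prems have g0: "g \<noteq> 0" by auto
  then have deg: "degree f = Suc (degree g)"
    by (simp add: g degree_mult_eq del: mult_pCons_left)
  with Suc.prems obtain e where e: "d = Suc e" "degree g \<le> e"
    by (metis Suc_le_D Suc_le_mono)
  define H where "H = (\<Sum>i\<le>e. act (coeff g i) (v ^ i * u ^ (e - i)))"
  have top: "coeff g d = 0"
    by (rule coeff_eq_0) (use e in simp)
  have "coeff f i = coeff (pCons 0 g) i - c * coeff g i" for i
    by (simp add: g)
  then have "0 = (\<Sum>i\<le>d. act (coeff (pCons 0 g) i) (v ^ i * u ^ (d - i))
      - act c (act (coeff g i) (v ^ i * u ^ (d - i))))"
    by (simp add: Suc.prems(4)[symmetric] scale_left_diff_distrib)
  also have "\<dots> = (\<Sum>i\<le>d. act (coeff (pCons 0 g) i) (v ^ i * u ^ (d - i)))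
      - act c (\<Sum>i\<le>d. act (coeff g i) (v ^ i * u ^ (d - i)))"
    by (simp add: sum_subtractf scale_sum_right)
  also have "(\<Sum>i\<le>d. act (coeff (pCons 0 g) i) (v ^ i * u ^ (d - i))) = v * H"
    unfolding e(1) sum.atMost_Suc_shift
    by (simp add: H_def sum_distrib_left act_mult_right mult.assoc)
  also have "(\<Sum>i\<le>d. act (coeff g i) (v ^ i * u ^ (d - i))) = u * H"
    using top unfolding e(1) 
    by (simp add: H_def sum_distrib_left act_mult_right Suc_diff_le mult.left_commute)
  finally have "(v - act c u) * H = 0"
    by (simp add: left_diff_distrib act_mult)
  then consider "v = act c u" | "H = 0" by auto
  then show ?case
  proof cases
    case 2
    then show ?thesis
      using Suc.hyps(1)[of g e] Suc.hyps(2) deg g0 e(2) Suc.prems(3) by (simp add: H_def)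
  qed auto
qed

lemma monomials_independent:
  assumes u: "u \<noteq> 0" and v: "\<nexists>c. v = act c u"
    and sum: "(\<Sum>i\<le>d. act (a i) (v ^ i * u ^ (d - i))) = 0" and "i \<le> d"
  shows "a i = 0"
proof (rule ccontr)
  assume "a i \<noteq> 0"
  define f where "f = (\<Sum>i\<le>d. monom (a i) i)"
  have cf: "coeff f j = (if j \<le> d then a j else 0)" for j
    by (simp add: f_def coeff_sum)
  have "f \<noteq> 0"
    using cf[of i] \<open>a i \<noteq> 0\<close> \<open>i \<le> d\<close> by auto
  moreover have "degree f \<le> d"
    by (rule degree_le) (simp add: cf)
  moreover have "(\<Sum>i\<le>d. act (coeff f i) (v ^ i * u ^ (d - i))) = 0"
    using sum by (simp add: cf)
  ultimately show False
    using binary_form_root u v by blast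
qed

text \<open>
  If \<open>v\<close> were not a multiple of \<open>u\<close>, the \<open>N + 1\<close> monomials \<open>v ^ i * u ^ (N - i)\<close> would be linearly
  independent elements of the degree \<open>n * N\<close> piece, whose dimension is at most \<open>card F\<close> for every \<open>N\<close>.
  Already \<open>N = card F\<close> is a contradiction.
\<close>

lemma piece_proportional:
  assumes dim: "krull_dim TYPE('r) = 1" and fg: "finitely_generated_algebra act"
    and u: "u \<in> G n" "u \<noteq> 0" and v: "v \<in> G n"
  shows "\<exists>c. v = act c u"
proof (cases "n = 0")
  case True
  with u obtain c where c: "act c u = 1" using piece_0_unit by blast
  from True v obtain b where "v = act b 1" using degree_zero by auto
  with c have "v = act (b * c) u" using scale_scale[of b c u] by simp
  then show ?thesis ..
next
  case False
  then have "n > 0" by simp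
  show ?thesis
  proof (rule ccontr)
    assume not: "\<not> ?thesis"
    obtain F where F: "finite F" "F \<subseteq> (\<Union>d. G d)" "span (F \<union> range ((*) u)) = UNIV"
      by (rule finite_homogeneous_spanning_set_modulo[OF dim fg u])
    define N where "N = card F"
    obtain T where T: "finite T" "card T \<le> N" "G (n * N) \<subseteq> span T"
      using piece_spanned_by_bounded_set[OF F u(1) \<open>n > 0\<close>] N_def by metis
    define w where "w i = v ^ i * u ^ (N - i)" for i
    note indep = monomials_independent[OF u(2) not, where d = N, folded w_def]
    have inj: "inj_on w {..N}"
    proof (rule inj_onI, rule ccontr)
      fix i j assume ij: "i \<in> {..N}" "j \<in> {..N}" "w i = w j" "i \<noteq> j"
      define a :: "nat \<Rightarrow> 'k" where "a k = (if k = i then 1 else 0) - (if k = j then 1 else 0)" for k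
      have "(\<Sum>k\<le>N. act (a k) (w k)) =
          (\<Sum>k\<le>N. if k = i then w k else 0) - (\<Sum>k\<le>N. if k = j then w k else 0)"
        by (subst sum_subtractf[symmetric], rule sum.cong) (auto simp: a_def scale_left_diff_distrib)
      also have "\<dots> = 0" using ij by simp
      finally have "a i = 0" by (rule indep) (use ij in simp)
      with ij(4) show False by (simp add: a_def)
    qed
    have "independent (w ` {..N})"
    proof
      assume "dependent (w ` {..N})"
      then obtain b where b: "\<exists>x\<in>w ` {..N}. b x \<noteq> 0" "(\<Sum>x\<in>w ` {..N}. act (b x) x) = 0"
        by (auto simp: dependent_finite)
      from b(2) have "(\<Sum>i\<le>N. act (b (w i)) (w i)) = 0"
        by (simp add: sum.reindex[OF inj])
      from indep[OF this] b(1) show False by auto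
    qed
    moreover have "w ` {..N} \<subseteq> G (n * N)"
    proof safe
      fix i assume "i \<le> N"
      then have "n * N = n * i + n * (N - i)" by (simp add: algebra_simps)
      then show "w i \<in> G (n * N)"
        unfolding w_def using piece_mult[OF power_in_piece[OF v, of i] power_in_piece[OF u(1), of "N - i"]]
        by simp
    qed
    ultimately have "card (w ` {..N}) \<le> card T"
      using independent_span_bound[OF T(1)] T(3) by blast
    with T(2) show False by (simp add: card_image[OF inj])
  qed
qed

end

section \<open>Degrees of a graded domain\<close>

text \<open>
  The number \<open>g\<close> is the least positive difference of two elements \<open>b\<close> and \<open>b + g\<close> of \<open>S\<close>. Division with
  remainder shows that \<open>g\<close> divides all of \<open>S\<close>; write \<open>b = g * k\<close>. Combinations of \<open>b\<close> and \<open>b + g\<close> with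
  \<open>q - r\<close> and \<open>r\<close> copies represent \<open>g * (k * q + r)\<close>, which covers all multiples of \<open>g\<close> from
  \<open>g * (k * k)\<close> on, since then the quotient \<open>q\<close> by \<open>k\<close> is at least the remainder \<open>r\<close>.
\<close>

lemma nat_submonoid_eventually_multiples:
  fixes S :: "nat set"
  assumes zero: "0 \<in> S" and add: "\<And>a b. a \<in> S \<Longrightarrow> b \<in> S \<Longrightarrow> a + b \<in> S"
    and pos: "s \<in> S" "s > 0"
  shows "\<exists>g>0. (\<forall>a\<in>S. g dvd a) \<and> (\<exists>c. \<forall>m\<ge>c. g dvd m \<longrightarrow> m \<in> S)"
proof -
  have mult: "k * a \<in> S" if "a \<in> S" for k a
    by (induction k) (use that zero add in auto)
  define D where "D d \<longleftrightarrow> d > 0 \<and> (\<exists>b\<in>S. b + d \<in> S)" for d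
  define g where "g = (LEAST d. D d)"
  have "D s" using pos zero by (auto simp: D_def intro!: bexI[of _ 0])
  then have "D g" unfolding g_def by (rule LeastI)
  then obtain b where g: "g > 0" and b: "b \<in> S" "b + g \<in> S"
    by (auto simp: D_def)
  have dvd: "g dvd a" if a: "a \<in> S" for a
  proof (rule ccontr)
    assume "\<not> g dvd a"
    then have r: "a mod g > 0" by (simp add: dvd_eq_mod_eq_0)
    define t where "t = a div g"
    have "a = t * g + a mod g" by (simp add: t_def)
    then have "t * (b + g) + a mod g = a + t * b" by (simp add: algebra_simps)
    then have "t * (b + g) + a mod g \<in> S" using add a mult b(1) by simp
    then have "D (a mod g)" using r mult[OF b(2)] by (auto simp: D_def)
    then have "g \<le> a mod g" unfolding g_def by (rule Least_le)
    then show False using mod_less_divisor[OF g, of a] by linarith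
  qed
  from dvd[OF b(1)] obtain k where k: "b = g * k" ..
  have "m \<in> S" if m: "g * (k * k) \<le> m" "g dvd m" for m
  proof -
    obtain t where t: "m = g * t" using m(2) ..
    show ?thesis
    proof (cases "k = 0")
      case True
      with k b t mult show ?thesis by (simp add: mult.commute)
    next
      case False
      have "k * k \<le> t" using m(1) g by (simp add: t)
      then have "k \<le> t div k" using False by (simp add: less_eq_div_iff_mult_less_eq)
      moreover have "t mod k < k" using False by simp
      ultimately have le: "t mod k \<le> t div k" by linarith
      have "(t div k - t mod k) * b + (t mod k) * (b + g) = ((t div k - t mod k) + t mod k) * b + t mod k * g"
        by (simp only: add_mult_distrib add_mult_distrib2)
      also have "\<dots> = t div k * b + t mod k * g"
        using le by simp
      also have "\<dots> = g * (k * (t div k) + t mod k)"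
        by (simp only: k add_mult_distrib2 mult_ac)
      also have "\<dots> = m" by (simp add: t)
      finally show ?thesis using add mult b by metis
    qed
  qed
  with g dvd show ?thesis by blast
qed

locale one_dimensional_graded_domain = graded_domain act G
  for act :: "'k::alg_closed_field \<Rightarrow> 'r::idom \<Rightarrow> 'r" and G +
  assumes dim: "krull_dim TYPE('r) = 1" and fg: "finitely_generated_algebra act"
begin

lemma nonzero_degrees:
  "\<exists>g>0. (\<forall>j. G j \<noteq> {0} \<longrightarrow> g dvd j) \<and> (\<exists>c. \<forall>j\<ge>c. g dvd j \<longrightarrow> G j \<noteq> {0})"
proof -
  let ?S = "{j. G j \<noteq> {0}}"
  obtain n where n: "n \<in> ?S" "n > 0"
    by (rule exists_positive_piece[OF dim]) simp
  have "G 0 \<noteq> {0}"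
    using one_in_piece_0 by (metis singletonD zero_neq_one)
  then have "0 \<in> ?S" by simp
  moreover have "a + b \<in> ?S" if ab: "a \<in> ?S" "b \<in> ?S" for a b
  proof -
    have "0 \<in> G a" "0 \<in> G b" by (simp_all add: piece_subspace subspace_0)
    with ab obtain u v where "u \<in> G a" "u \<noteq> 0" "v \<in> G b" "v \<noteq> 0" by blast
    then have "u * v \<in> G (a + b)" "u * v \<noteq> 0" using piece_mult by auto
    then have "G (a + b) \<noteq> {0}" by (metis singletonD)
    then show ?thesis by simp
  qed
  ultimately have "\<exists>g>0. (\<forall>j\<in>?S. g dvd j) \<and> (\<exists>c. \<forall>j\<ge>c. g dvd j \<longrightarrow> j \<in> ?S)"
    by (rule nat_submonoid_eventually_multiples[OF _ _ n])
  then show ?thesis by simp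
qed

end

section \<open>Lengths of graded pieces\<close>

text \<open>
  A module generated by each of its nonzero elements has no submodules besides zero and itself.
\<close>

lemma module_length_line:
  assumes zero: "closed_submodule add zero act {zero}" and M: "closed_submodule add zero act M"
    and gen: "\<And>v w. v \<in> M \<Longrightarrow> v \<noteq> zero \<Longrightarrow> w \<in> M \<Longrightarrow> \<exists>c. w = act c v"
  shows "module_length add zero act M = (if M = {zero} then 0 else 1)"
proof (rule antisym)
  have dichotomy: "N = {zero} \<or> N = M" if N: "closed_submodule add zero act N" "N \<subseteq> M" for N
  proof (rule disjCI)
    assume "N \<noteq> M"
    have "zero \<in> N" using N(1) by (simp add: closed_submodule_def)
    moreover have "v = zero" if v: "v \<in> N" for v
    proof (rule ccontr)
      assume "v \<noteq> zero"
      have "w \<in> N" if "w \<in> M" for w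
        using gen[OF subsetD[OF N(2) v] \<open>v \<noteq> zero\<close> that] N(1) v by (auto simp: closed_submodule_def)
      with N(2) \<open>N \<noteq> M\<close> show False by blast
    qed
    ultimately show "N = {zero}" by blast
  qed
  show "module_length add zero act M \<le> (if M = {zero} then 0 else 1)"
    unfolding module_length_def
  proof (rule Sup_least, clarify)
    fix n and C :: "nat \<Rightarrow> 'a set"
    assume C: "\<forall>i\<le>n. closed_submodule add zero act (C i) \<and> C i \<subseteq> M" "\<forall>i<n. C i \<subset> C (Suc i)"
    have C_cases: "C i = {zero} \<or> C i = M" if "i \<le> n" for i
      using dichotomy C(1) that by blast
    show "enat n \<le> (if M = {zero} then 0 else 1)"
    proof (cases n)
      case 0
      then show ?thesis by (simp add: zero_enat_def[symmetric])
    next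
      case (Suc m)
      then have "C 0 \<subset> C 1" using C(2) by simp
      then have "C 1 = M" "M \<noteq> {zero}" using C_cases[of 0] C_cases[of 1] C(1) Suc by auto
      moreover have "m = 0"
      proof (rule ccontr)
        assume "m \<noteq> 0"
        then have "C 1 \<subset> C 2" "C 2 \<subseteq> M"
          using C Suc by (auto simp: numeral_2_eq_2)
        with \<open>C 1 = M\<close> show False by blast
      qed
      ultimately show ?thesis using Suc by (simp add: one_enat_def)
    qed
  qed
  show "(if M = {zero} then 0 else 1) \<le> module_length add zero act M"
  proof (cases "M = {zero}")
    case False
    have "zero \<in> M" using M by (simp add: closed_submodule_def)
    then have sub: "{zero} \<subset> M" using False by blast
    have "enat 1 \<le> module_length add zero act M"
      unfolding module_length_def
      by (rule Sup_upper, rule CollectI, rule exI[of _ 1], intro conjI refl,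
          rule exI[of _ "\<lambda>i. if i = 0 then {zero} else M"])
         (use zero M sub in auto)
    with False show ?thesis by (simp add: one_enat_def)
  qed simp
qed

lemma ideal_coset_eq_self_iff:
  assumes J: "is_ideal J"
  shows "ideal_coset J x = J \<longleftrightarrow> x \<in> J"
proof
  show "x \<in> J" if "ideal_coset J x = J"
  proof -
    have "x + 0 \<in> ideal_coset J x"
      unfolding ideal_coset_def using ideal.subspace_0[OF J] by blast
    with that show ?thesis by simp
  qed
  assume x: "x \<in> J"
  show "ideal_coset J x = J"
  proof (intro set_eqI iffI)
    show "y \<in> J" if "y \<in> ideal_coset J x" for y
      using that x ideal.subspace_add[OF J] by (auto simp: ideal_coset_def)
    show "y \<in> ideal_coset J x" if "y \<in> J" for y
      unfolding ideal_coset_def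
      using ideal.subspace_diff[OF J that x] by (auto intro!: exI[of _ "y - x"])
  qed
qed

lemma ideal_coset_add_coset:
  assumes J: "is_ideal J"
  shows "ideal_coset_add (ideal_coset J x) (ideal_coset J y) = ideal_coset J (x + y)"
proof (intro set_eqI iffI)
  fix z assume "z \<in> ideal_coset_add (ideal_coset J x) (ideal_coset J y)"
  then obtain i j where "i \<in> J" "j \<in> J" "z = (x + i) + (y + j)"
    by (auto simp: ideal_coset_add_def ideal_coset_def)
  then have "z = (x + y) + (i + j)" "i + j \<in> J"
    using ideal.subspace_add[OF J] by (auto simp: algebra_simps)
  then show "z \<in> ideal_coset J (x + y)"
    unfolding ideal_coset_def by blast
next
  fix z assume "z \<in> ideal_coset J (x + y)"
  then obtain j where j: "j \<in> J" "z = (x + 0) + (y + j)"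
    by (auto simp: ideal_coset_def algebra_simps)
  then show "z \<in> ideal_coset_add (ideal_coset J x) (ideal_coset J y)"
    unfolding ideal_coset_add_def ideal_coset_def using ideal.subspace_0[OF J] by blast
qed

lemma (in algebra_over_field) ideal_coset_act_coset:
  assumes J: "is_ideal J"
  shows "ideal_coset_act act J c (ideal_coset J x) = ideal_coset J (act c x)"
proof (intro set_eqI iffI)
  fix z assume "z \<in> ideal_coset_act act J c (ideal_coset J x)"
  then obtain i j where "i \<in> J" "j \<in> J" "z = act c (x + i) + j"
    by (auto simp: ideal_coset_act_def ideal_coset_def)
  then have "z = act c x + (act c i + j)" "act c i + j \<in> J"
    using ideal.subspace_add[OF J] ideal_act_closed[OF J] by (auto simp: scale_right_distrib add.assoc)
  then show "z \<in> ideal_coset J (act c x)"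
    unfolding ideal_coset_def by blast
next
  fix z assume "z \<in> ideal_coset J (act c x)"
  then obtain j where j: "j \<in> J" "z = act c (x + 0) + j"
    by (auto simp: ideal_coset_def)
  then show "z \<in> ideal_coset_act act J c (ideal_coset J x)"
    unfolding ideal_coset_act_def ideal_coset_def using ideal.subspace_0[OF J] by blast
qed

context one_dimensional_graded_domain
begin

lemmas proportional = piece_proportional[OF dim fg]

lemma module_length_piece: "module_length (+) 0 act (G j) = (if G j = {0} then 0 else 1)"
proof (rule module_length_line)
  show "closed_submodule (+) 0 act (G j)"
    using piece_subspace[of j] unfolding closed_submodule_def subspace_def by blast
qed (auto simp: closed_submodule_def intro: proportional)

lemma quotient_length_piece:
  assumes J: "is_ideal J"
  shows "quotient_length act J (G j) = (if G j \<subseteq> J then 0 else 1)"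
proof -
  have G: "0 \<in> G j" "\<And>x y. x \<in> G j \<Longrightarrow> y \<in> G j \<Longrightarrow> x + y \<in> G j" "\<And>c x. x \<in> G j \<Longrightarrow> act c x \<in> G j"
    using piece_subspace[of j] by (auto simp: subspace_def)
  have zero: "ideal_coset J 0 = J"
    by (simp add: ideal_coset_eq_self_iff[OF J] ideal.subspace_0[OF J])
  have image: "ideal_coset J ` G j = {J} \<longleftrightarrow> G j \<subseteq> J"
    using G(1) zero ideal_coset_eq_self_iff[OF J] by auto
  have "module_length ideal_coset_add J (ideal_coset_act act J) (ideal_coset J ` G j)
      = (if ideal_coset J ` G j = {J} then 0 else 1)"
  proof (rule module_length_line)
    show "closed_submodule ideal_coset_add J (ideal_coset_act act J) {J}"
      using ideal_coset_add_coset[OF J, of 0 0] ideal_coset_act_coset[OF J, of _ 0]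
      by (simp add: closed_submodule_def zero)
    show "closed_submodule ideal_coset_add J (ideal_coset_act act J) (ideal_coset J ` G j)"
      using G zero
      by (auto simp: closed_submodule_def ideal_coset_add_coset[OF J] ideal_coset_act_coset[OF J]
               intro!: image_eqI[of J _ 0])
    fix V W assume "V \<in> ideal_coset J ` G j" "V \<noteq> J" "W \<in> ideal_coset J ` G j"
    then obtain v w where v: "V = ideal_coset J v" "v \<in> G j" "v \<noteq> 0" and w: "W = ideal_coset J w" "w \<in> G j"
      using zero by blast
    from proportional[OF v(2,3) w(2)] obtain c where "w = act c v" ..
    then have "W = ideal_coset_act act J c V"
      by (simp add: v(1) w(1) ideal_coset_act_coset[OF J])
    then show "\<exists>c. W = ideal_coset_act act J c V" ..
  qed
  then show ?thesis
    by (simp add: quotient_length_def image)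
qed

end

text \<open>
  The powers of a nonzero nonunit generate an infinite strictly descending chain of ideals.
\<close>

lemma infinite_colength_zero_ideal:
  fixes x :: "'r::idom"
  assumes x: "x \<noteq> 0" "\<not> x dvd 1"
  shows "\<not> has_finite_colength {0 :: 'r}"
proof -
  have coset: "ideal_coset {0} = (\<lambda>r :: 'r. {r})"
    by (auto simp: ideal_coset_def)
  have "enat n \<le> quotient_length (*) {0 :: 'r} UNIV" for n
  proof -
    define C where "C i = range (\<lambda>r. {x ^ (n - i) * r})" for i
    have "closed_submodule ideal_coset_add {0} (ideal_coset_act (*) {0}) (C i)" for i
      unfolding closed_submodule_def
    proof (intro conjI ballI allI)
      show "{0} \<in> C i" unfolding C_def by (rule image_eqI[of _ _ 0]) auto
      show "ideal_coset_add A B \<in> C i" if AB: "A \<in> C i" "B \<in> C i" for A B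
      proof -
        from AB obtain r s where "A = {x ^ (n - i) * r}" "B = {x ^ (n - i) * s}"
          by (auto simp: C_def)
        then have "ideal_coset_add A B = {x ^ (n - i) * (r + s)}"
          by (simp add: ideal_coset_add_def distrib_left)
        then show ?thesis unfolding C_def by blast
      qed
      show "ideal_coset_act (*) {0} c A \<in> C i" if A: "A \<in> C i" for c A
      proof -
        from A obtain r where "A = {x ^ (n - i) * r}"
          by (auto simp: C_def)
        then have "ideal_coset_act (*) {0} c A = {x ^ (n - i) * (c * r)}"
          by (simp add: ideal_coset_act_def mult.left_commute)
        then show ?thesis unfolding C_def by blast
      qed
    qed
    moreover have "C i \<subset> C (Suc i)" if i: "i < n" for i
    proof
      have power: "x ^ (n - i) = x ^ (n - Suc i) * x"
        using i by (simp add: Suc_diff_Suc flip: power_Suc2)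
      then have "{x ^ (n - i) * r} = {x ^ (n - Suc i) * (x * r)}" for r
        by (simp add: mult.assoc)
      then show "C i \<subseteq> C (Suc i)" unfolding C_def by blast
      have "x ^ (n - Suc i) \<noteq> x ^ (n - Suc i) * x * r" for r
      proof
        assume "x ^ (n - Suc i) = x ^ (n - Suc i) * x * r"
        then have "x ^ (n - Suc i) * 1 = x ^ (n - Suc i) * (x * r)"
          by (simp only: mult.assoc mult_1_right)
        then have "1 = x * r" using x(1) by simp
        with x(2) show False by (metis dvd_triv_left)
      qed
      then have "{x ^ (n - Suc i) * 1} \<notin> C i"
        unfolding C_def power by auto
      moreover have "{x ^ (n - Suc i) * 1} \<in> C (Suc i)"
        unfolding C_def by blast
      ultimately show "C i \<noteq> C (Suc i)" by blast
    qed
    moreover have "C i \<subseteq> ideal_coset {0} ` UNIV" for i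
      by (auto simp: C_def coset)
    ultimately show ?thesis
      unfolding quotient_length_def module_length_def by (intro Sup_upper) blast
  qed
  then have "quotient_length (*) {0 :: 'r} UNIV = \<infinity>"
    by (metis enat_ord_simps(1) not_infinity_eq not_less_eq_eq order_refl)
  then show ?thesis
    by (simp add: has_finite_colength_def)
qed

section \<open>Asymptotics of exponential sums\<close>

lemma exp_difference_quotient:
  fixes w :: complex
  shows "((\<lambda>t. (exp (w * t) - 1) / t) \<longlongrightarrow> w) (at 0)"
proof -
  have "((\<lambda>t. exp (w * t)) has_field_derivative w) (at 0)"
    by (auto intro!: derivative_eq_intros)
  then show ?thesis
    by (simp add: has_field_derivative_iff)
qed

text \<open>
  With \<open>t = 1 / q n\<close>, the closed form of the geometric sum, multiplied by \<open>t\<close>, has denominator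
  \<open>(exp (w * t) - 1) / t\<close>, which tends to \<open>w\<close>. The limit is the integral of \<open>exp (w * s)\<close> over
  \<open>s\<close> from \<open>0\<close> to \<open>k\<close>.
\<close>

lemma geometric_sum_limit:
  fixes w :: complex and q :: "nat \<Rightarrow> nat"
  assumes q: "filterlim q at_top sequentially"
  shows "(\<lambda>n. 1 / of_nat (q n) * (\<Sum>m<q n * k. exp (w / of_nat (q n)) ^ m))
    \<longlonglongrightarrow> (if w = 0 then of_nat k else (exp (w * of_nat k) - 1) / w)"
proof -
  have "\<forall>\<^sub>F n in sequentially. 1 \<le> q n"
    using q unfolding filterlim_at_top by blast
  then have q_pos: "\<forall>\<^sub>F n in sequentially. q n > 0"
    by eventually_elim simp
  show ?thesis
  proof (cases "w = 0")
    case True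
    have "\<forall>\<^sub>F n in sequentially. 1 / of_nat (q n) * (\<Sum>m<q n * k. exp (w / of_nat (q n)) ^ m) = of_nat k"
      using q_pos by eventually_elim (simp add: True)
    from tendsto_eventually[OF this] show ?thesis
      unfolding if_P[OF True] .
  next
    case False
    define t :: "nat \<Rightarrow> complex" where "t n = 1 / of_nat (q n)" for n
    define Q where "Q n = (exp (w * t n) - 1) / t n" for n
    have "filterlim (\<lambda>n. of_nat (q n) :: complex) at_infinity sequentially"
      using filterlim_compose[OF tendsto_of_nat q] .
    then have "t \<longlonglongrightarrow> 0"
      unfolding t_def using tendsto_divide_0[OF tendsto_const] by blast
    moreover have "\<forall>\<^sub>F n in sequentially. t n \<noteq> 0"
      using q_pos by eventually_elim (simp add: t_def)
    ultimately have "filterlim t (at 0) sequentially"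
      by (simp add: filterlim_at)
    from filterlim_compose[OF exp_difference_quotient[of w] this] have Q: "Q \<longlonglongrightarrow> w"
      by (simp add: Q_def[abs_def])
    then have "\<forall>\<^sub>F n in sequentially. Q n \<noteq> 0"
      using False by (rule tendsto_imp_eventually_ne)
    then have "\<forall>\<^sub>F n in sequentially. (exp (w * of_nat k) - 1) / Q n
        = 1 / of_nat (q n) * (\<Sum>m<q n * k. exp (w / of_nat (q n)) ^ m)"
      using q_pos
    proof eventually_elim
      case (elim n)
      define E where "E = exp (w / of_nat (q n))"
      have "E \<noteq> 1" using elim by (auto simp: Q_def t_def E_def)
      have "E ^ (q n * k) = exp (w * of_nat k)"
        unfolding E_def exp_of_nat_mult[symmetric] using elim by (simp add: field_simps)
      then have "(\<Sum>m<q n * k. E ^ m) = (exp (w * of_nat k) - 1) / (E - 1)"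
        using geometric_sum[OF \<open>E \<noteq> 1\<close>] by simp
      then show ?case by (simp add: E_def Q_def t_def)
    qed
    moreover have "(\<lambda>n. (exp (w * of_nat k) - 1) / Q n) \<longlonglongrightarrow> (exp (w * of_nat k) - 1) / w"
      using Q False by (intro tendsto_intros)
    ultimately show ?thesis
      using False by (simp add: Lim_transform_eventually)
  qed
qed

lemma sum_multiples:
  fixes f :: "nat \<Rightarrow> 'a::comm_monoid_add"
  assumes "g > 0"
  shows "(\<Sum>j | j < g * N \<and> g dvd j. f j) = (\<Sum>m<N. f (g * m))"
proof -
  have "{j. j < g * N \<and> g dvd j} = (*) g ` {..<N}"
    using assms by (auto simp: dvd_def)
  then show ?thesis
    using assms by (simp add: sum.reindex inj_on_def)
qed

text \<open>
  The coefficients \<open>a n\<close> agree with the indicator function of the multiples of \<open>g\<close> below \<open>q n * h\<close>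
  with at most \<open>2 * c\<close> exceptions. The exponentials there are bounded uniformly in \<open>n\<close>,
  so the exceptions vanish in the limit, and a geometric sum remains.
\<close>

lemma truncated_multiples_limit:
  fixes a :: "nat \<Rightarrow> nat \<Rightarrow> nat" and q :: "nat \<Rightarrow> nat" and y :: complex
  assumes q: "filterlim q at_top sequentially" and q_pos: "\<And>n. q n > 0" and g: "g > 0" and "g dvd h"
    and le_1: "\<And>n j. a n j \<le> 1"
    and below: "\<And>n j. c \<le> j \<Longrightarrow> j < q n * h \<Longrightarrow> a n j = of_bool (g dvd j)"
    and above: "\<And>n j. q n * h + c \<le> j \<Longrightarrow> a n j = 0"
  shows "(\<lambda>n. 1 / of_nat (q n) * (\<Sum>\<^sub>\<infinity>j. of_nat (a n j) * exp (- \<i> * y * of_nat j / of_nat (q n))))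
    \<longlonglongrightarrow> 1 / of_nat g * (if y = 0 then of_nat h else (1 - exp (- \<i> * of_nat h * y)) / (\<i> * y))"
proof -
  obtain k where k: "h = g * k" using \<open>g dvd h\<close> ..
  define e where "e n j = exp (- \<i> * y * of_nat j / of_nat (q n))" for n j
  define b :: "nat \<Rightarrow> nat \<Rightarrow> complex" where "b n j = of_bool (j < q n * h \<and> g dvd j)" for n j
  define main where "main n = (\<Sum>j | j < q n * h \<and> g dvd j. e n j)" for n
  define err where "err n = (\<Sum>j<q n * h + c. (of_nat (a n j) - b n j) * e n j)" for n
  define K where "K = exp (norm y * (real h + real c))"
  have split: "(\<Sum>\<^sub>\<infinity>j. of_nat (a n j) * e n j) = main n + err n" for n
  proof -
    have "(\<Sum>\<^sub>\<infinity>j. of_nat (a n j) * e n j) = (\<Sum>\<^sub>\<infinity>j\<in>{..<q n * h + c}. of_nat (a n j) * e n j)"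
      by (rule infsum_cong_neutral) (auto simp: above)
    also have "\<dots> = (\<Sum>j<q n * h + c. of_nat (a n j) * e n j)"
      by simp
    also have "\<dots> = (\<Sum>j<q n * h + c. b n j * e n j) + err n"
      by (simp add: err_def sum.distrib[symmetric] algebra_simps)
    also have "(\<Sum>j<q n * h + c. b n j * e n j) = main n"
      unfolding main_def by (rule sum.mono_neutral_cong_right) (auto simp: b_def)
    finally show ?thesis .
  qed
  have err_bound: "norm (err n) \<le> real (2 * c) * K" for n
  proof -
    let ?A = "{..<c} \<union> {q n * h..<q n * h + c}"
    have "err n = (\<Sum>j\<in>?A. (of_nat (a n j) - b n j) * e n j)"
      unfolding err_def by (rule sum.mono_neutral_right) (auto simp: b_def below)
    also have "norm \<dots> \<le> real (card ?A) * K"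
    proof (rule sum_norm_bound)
      fix j assume "j \<in> ?A"
      then have "j < q n * h + c" by auto
      also have "\<dots> \<le> q n * (h + c)" using q_pos[of n] by (simp add: add_mult_distrib2)
      finally have "real j \<le> real (q n) * (real h + real c)"
        by (metis less_imp_le of_nat_add of_nat_le_iff of_nat_mult)
      then have "real j / real (q n) \<le> real h + real c"
        using q_pos[of n] by (simp add: divide_le_eq mult.commute)
      then have "norm y * (real j / real (q n)) \<le> norm y * (real h + real c)"
        by (rule mult_left_mono) simp
      moreover have "norm (e n j) \<le> exp (norm (- \<i> * y * of_nat j / of_nat (q n)))"
        unfolding e_def by (rule norm_exp)
      ultimately have "norm (e n j) \<le> K"
        unfolding K_def by (simp add: norm_mult norm_divide) (meson exp_le_cancel_iff order_trans)
      moreover have "a n j = 0 \<or> a n j = 1" using le_1[of n j] by linarith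
      then have "norm (of_nat (a n j) - b n j) \<le> 1" by (auto simp: b_def)
      ultimately have "norm (of_nat (a n j) - b n j) * norm (e n j) \<le> 1 * K"
        by (intro mult_mono) auto
      then show "norm ((of_nat (a n j) - b n j) * e n j) \<le> K"
        by (simp add: norm_mult)
    qed
    also have "\<dots> \<le> real (2 * c) * K"
    proof (rule mult_right_mono)
      have "card ?A \<le> c + c"
        using card_Un_le[of "{..<c}" "{q n * h..<q n * h + c}"] by simp
      then show "real (card ?A) \<le> real (2 * c)" by simp
    qed (simp add: K_def)
    finally show ?thesis .
  qed
  have "(\<lambda>n. 1 / of_nat (q n) * err n) \<longlonglongrightarrow> 0"
  proof (rule Lim_null_comparison)
    have "norm (1 / of_nat (q n) * err n) \<le> real (2 * c) * K / real (q n)" for n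
      using divide_right_mono[OF err_bound[of n], of "real (q n)"] by (simp add: norm_divide norm_mult)
    then show "\<forall>\<^sub>F n in sequentially. norm (1 / of_nat (q n) * err n) \<le> real (2 * c) * K / real (q n)"
      by simp
    show "(\<lambda>n. real (2 * c) * K / real (q n)) \<longlonglongrightarrow> 0"
      by (rule real_tendsto_divide_at_top[OF tendsto_const])
         (rule filterlim_compose[OF filterlim_real_sequentially q])
  qed
  moreover have "(\<lambda>n. 1 / of_nat (q n) * main n)
      \<longlonglongrightarrow> 1 / of_nat g * (if y = 0 then of_nat h else (1 - exp (- \<i> * of_nat h * y)) / (\<i> * y))"
  proof -
    define w where "w = - \<i> * y * of_nat g"
    have "main n = (\<Sum>m<q n * k. exp (w / of_nat (q n)) ^ m)" for n
    proof -
      have "q n * h = g * (q n * k)" by (simp add: k)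
      then have "main n = (\<Sum>m<q n * k. e n (g * m))"
        by (simp only: main_def sum_multiples[OF g])
      also have "\<dots> = (\<Sum>m<q n * k. exp (w / of_nat (q n)) ^ m)"
        by (simp add: e_def w_def exp_of_nat_mult[symmetric] mult_ac)
      finally show ?thesis .
    qed
    moreover have "(if w = 0 then of_nat k else (exp (w * of_nat k) - 1) / w)
        = 1 / of_nat g * (if y = 0 then of_nat h else (1 - exp (- \<i> * of_nat h * y)) / (\<i> * y))"
      using g by (simp add: w_def k field_simps)
    ultimately show ?thesis
      using geometric_sum_limit[OF q, where k = k and w = w] by simp
  qed
  ultimately have "(\<lambda>n. 1 / of_nat (q n) * main n + 1 / of_nat (q n) * err n)
      \<longlonglongrightarrow> 1 / of_nat g * (if y = 0 then of_nat h else (1 - exp (- \<i> * of_nat h * y)) / (\<i> * y)) + 0"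
    by (rule tendsto_add[rotated])
  then show ?thesis
    by (simp only: e_def[symmetric] split distrib_left add_0_right)
qed

lemma density_multiples:
  assumes g: "g > 0" and dvd: "\<And>j. j \<in> S \<Longrightarrow> g dvd j"
    and eventually: "\<And>j. c \<le> j \<Longrightarrow> g dvd j \<Longrightarrow> j \<in> S"
  shows "(\<lambda>n. real (card {j. j \<le> n \<and> j \<in> S}) / real n) \<longlonglongrightarrow> 1 / real g"
proof -
  have multiples: "card {j. j \<le> n \<and> g dvd j} = n div g + 1" for n
  proof -
    have "{j. j \<le> n \<and> g dvd j} = (*) g ` {..n div g}"
      using g by (auto simp: dvd_def less_eq_div_iff_mult_less_eq mult.commute)
    then show ?thesis
      using g by (simp add: card_image inj_on_def)
  qed
  have upper: "real (card {j. j \<le> n \<and> j \<in> S}) \<le> real n / real g + 1" for n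
  proof -
    have "card {j. j \<le> n \<and> j \<in> S} \<le> card {j. j \<le> n \<and> g dvd j}"
      using dvd by (intro card_mono) auto
    also have "real \<dots> \<le> real n / real g + 1"
      unfolding multiples using of_nat_div_le_of_nat[of n g, where 'a = real] by simp
    finally show ?thesis by simp
  qed
  have lower: "real n / real g - real c \<le> real (card {j. j \<le> n \<and> j \<in> S})" for n
  proof -
    have "n < g * (n div g + 1)"
      using dividend_less_times_div[OF g, of n] by simp
    then have "real n \<le> real g * real (n div g + 1)"
      by (metis less_imp_le of_nat_le_iff of_nat_mult)
    then have "real n / real g \<le> real (n div g + 1)"
      using g by (simp add: divide_le_eq mult.commute)
    also have "n div g + 1 = card {j. j \<le> n \<and> g dvd j}"
      by (simp add: multiples)
    also have "\<dots> \<le> card ({j. j \<le> n \<and> j \<in> S} \<union> {..<c})"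
      using eventually by (intro card_mono) auto
    also have "\<dots> \<le> card {j. j \<le> n \<and> j \<in> S} + c"
      using card_Un_le[of "{j. j \<le> n \<and> j \<in> S}" "{..<c}"] by simp
    finally show ?thesis by simp
  qed
  have "(\<lambda>n. (real n / real g + r) / real n) \<longlonglongrightarrow> inverse (real g)" for r
    using g by real_asymp
  then have lim: "(\<lambda>n. (real n / real g + r) / real n) \<longlonglongrightarrow> 1 / real g" for r
    by (simp add: inverse_eq_divide)
  show ?thesis
  proof (rule tendsto_sandwich)
    show "\<forall>\<^sub>F n in sequentially. (real n / real g + (- real c)) / real n
        \<le> real (card {j. j \<le> n \<and> j \<in> S}) / real n"
      using lower by (intro always_eventually allI divide_right_mono) auto
    show "\<forall>\<^sub>F n in sequentially. real (card {j. j \<le> n \<and> j \<in> S}) / real n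
        \<le> (real n / real g + 1) / real n"
      using upper by (intro always_eventually allI divide_right_mono) auto
  qed (rule lim)+
qed

lemma remove_sings_exp_quotient:
  "remove_sings (\<lambda>z. of_real r * ((1 - exp (- \<i> * of_nat h * z)) / (\<i> * z))) y
    = of_real r * (if y = 0 then of_nat h else (1 - exp (- \<i> * of_nat h * y)) / (\<i> * y))"
proof (rule remove_sings_eqI)
  show "((\<lambda>z. of_real r * ((1 - exp (- \<i> * of_nat h * z)) / (\<i> * z)))
      \<longlongrightarrow> of_real r * (if y = 0 then of_nat h else (1 - exp (- \<i> * of_nat h * y)) / (\<i> * y))) (at y)"
  proof (cases "y = 0")
    case True
    have "((\<lambda>z. of_real r * (\<i> * ((exp ((- \<i> * of_nat h) * z) - 1) / z)))
        \<longlongrightarrow> of_real r * (\<i> * (- \<i> * of_nat h))) (at 0)"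
      by (intro tendsto_intros exp_difference_quotient)
    moreover have eq: "\<i> * ((exp ((- \<i> * of_nat h) * z) - 1) / z) = (1 - exp (- \<i> * of_nat h * z)) / (\<i> * z)" for z
      by (cases "z = 0") (simp_all add: field_simps)
    ultimately show ?thesis
      unfolding True eq by simp
  next
    case False
    then show ?thesis
      by (auto intro!: tendsto_eq_intros)
  qed
qed

section \<open>The Frobenius-Poincare function\<close>

context one_dimensional_graded_domain
begin

text \<open>
  The Hilbert function is the indicator function of the set of nonzero degrees, so the
  multiplicity is the density of this set.
\<close>

lemma hilbert_samuel_multiplicity_eq:
  assumes "g > 0" "\<And>j. G j \<noteq> {0} \<Longrightarrow> g dvd j" "\<And>j. c \<le> j \<Longrightarrow> g dvd j \<Longrightarrow> G j \<noteq> {0}"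
  shows "hilbert_samuel_multiplicity act G = 1 / real g"
proof -
  have "(\<Sum>j\<le>n. real (the_enat (module_length (+) 0 act (G j)))) = real (card {j. j \<le> n \<and> j \<in> {j. G j \<noteq> {0}}})" for n
  proof -
    have "(\<Sum>j\<le>n. real (the_enat (module_length (+) 0 act (G j)))) = (\<Sum>j\<le>n. if G j \<noteq> {0} then 1 else 0)"
      by (rule sum.cong) (simp_all add: module_length_piece zero_enat_def one_enat_def)
    also have "\<dots> = real (card {j \<in> {..n}. G j \<noteq> {0}})"
      by (simp add: sum.If_cases Int_def)
    finally show ?thesis by simp
  qed
  then have "hilbert_samuel_multiplicity act G
      = lim (\<lambda>n. real (card {j. j \<le> n \<and> j \<in> {j. G j \<noteq> {0}}}) / real n)"
    by (simp add: hilbert_samuel_multiplicity_def dim one_enat_def)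
  also have "\<dots> = 1 / real g"
    by (rule limI, rule density_multiples) (use assms in auto)
  finally show ?thesis .
qed

text \<open>
  The zero ideal of \<open>R\<close> has infinite colength because a homogeneous element of positive degree is
  not a unit. This ensures that the least degree \<open>h\<close> in the theorem exists.
\<close>

lemma ideal_nonzero:
  assumes "has_finite_colength (I :: 'r set)"
  shows "I \<noteq> {0}"
proof
  assume "I = {0}"
  obtain n where n: "n > 0" "G n \<noteq> {0}"
    using exists_positive_piece[OF dim] .
  moreover have "0 \<in> G n" by (simp add: piece_subspace subspace_0)
  ultimately obtain x where x: "x \<in> G n" "x \<noteq> 0" by blast
  have "x * r \<noteq> 1" for r
  proof
    assume "x * r = 1"
    then have "component 0 1 = 0"
      using component_mult_homogeneous[OF x(1), of 0 r] n(1) by simp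
    then show False by (simp add: component_homogeneous[OF one_in_piece_0])
  qed
  then have "\<not> x dvd 1" by (metis dvd_def)
  with infinite_colength_zero_ideal[OF x(2)] assms \<open>I = {0}\<close> show False by simp
qed

lemma initial_degree:
  assumes hom: "is_homogeneous_ideal G I" and "I \<noteq> {0}"
    and h: "h = (LEAST m. \<exists>x\<in>I. x \<noteq> 0 \<and> x \<in> G m)"
  obtains x where "x \<in> I" "x \<noteq> 0" "x \<in> G h" "I \<subseteq> tail h"
proof -
  obtain S where S: "S \<subseteq> (\<Union>n. G n)" "I = ideal_generated_by S"
    using hom by (auto simp: is_homogeneous_ideal_def)
  have "S \<subseteq> I" by (simp add: S(2) ideal.span_superset)
  have "\<exists>s\<in>S. s \<noteq> 0"
  proof (rule ccontr)
    assume "\<not> ?thesis"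
    then have "I \<subseteq> {0}"
      unfolding S(2) by (intro ideal.span_minimal) auto
    with \<open>I \<noteq> {0}\<close> show False
      using ideal.span_zero[of S] S(2) by auto
  qed
  then have "\<exists>m. \<exists>x\<in>I. x \<noteq> 0 \<and> x \<in> G m"
    using S(1) \<open>S \<subseteq> I\<close> by blast
  from LeastI_ex[OF this] obtain x where x: "x \<in> I" "x \<noteq> 0" "x \<in> G h"
    unfolding h by blast
  have "s \<in> tail h" if s: "s \<in> S" for s
  proof (cases "s = 0")
    case True
    then show ?thesis using ideal.subspace_0[OF is_ideal_tail] by simp
  next
    case False
    obtain m where m: "s \<in> G m" using s S(1) by blast
    have "h \<le> m"
      unfolding h by (rule Least_le) (use s \<open>S \<subseteq> I\<close> False m in blast)
    then show ?thesis using piece_subset_tail m by blast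
  qed
  then have "I \<subseteq> tail h"
    unfolding S(2) by (intro ideal.span_minimal is_ideal_tail subsetI)
  with x show thesis by (rule that)
qed

text \<open>
  Elements of \<open>I\<close> start in degree \<open>h\<close>, hence their \<open>q\<close>-th powers, and the ideal generated by these,
  start in degree \<open>q * h\<close>.
\<close>

lemma piece_below_frobenius_power:
  assumes "I \<subseteq> tail h" "j < q * h"
  shows "G j \<subseteq> frobenius_power I q \<longleftrightarrow> G j = {0}"
proof
  assume sub: "G j \<subseteq> frobenius_power I q"
  have "v = 0" if v: "v \<in> G j" for v
  proof -
    have "v \<in> tail (q * h)" using v sub frobenius_power_subset_tail[OF assms(1)] by blast
    then show "v = 0" using assms(2) component_homogeneous[OF v, of j] by (simp add: tail_def)
  qed
  then show "G j = {0}" using subspace_0[OF piece_subspace] by blast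
next
  assume "G j = {0}"
  then show "G j \<subseteq> frobenius_power I q"
    by (simp add: frobenius_power_def ideal.span_zero)
qed

text \<open>
  Multiplying \<open>x ^ q\<close> by an element of degree \<open>j - q * h\<close> gives a nonzero element of the line \<open>G j\<close>.
\<close>

lemma piece_in_frobenius_power:
  assumes x: "x \<in> I" "x \<noteq> 0" "x \<in> G h" and "q * h \<le> j" and "G (j - q * h) \<noteq> {0}"
  shows "G j \<subseteq> frobenius_power I q"
proof
  fix v assume v: "v \<in> G j"
  have ideal: "is_ideal (frobenius_power I q)"
    by (simp add: frobenius_power_def ideal.subspace_span)
  have "0 \<in> G (j - q * h)" by (simp add: piece_subspace subspace_0)
  with assms(5) obtain w where w: "w \<in> G (j - q * h)" "w \<noteq> 0" by blast
  have "x ^ q \<in> frobenius_power I q"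
    unfolding frobenius_power_def by (rule ideal.span_base) (use x in blast)
  then have "w * x ^ q \<in> frobenius_power I q"
    by (rule ideal.subspace_scale[OF ideal])
  moreover have "w * x ^ q \<in> G j"
    using piece_mult[OF w(1) power_in_piece[OF x(3), of q]] assms(4) by (simp add: mult.commute)
  with v w(2) x(2) obtain c where "v = act c (w * x ^ q)"
    using proportional[of "w * x ^ q" j v] by auto
  ultimately show "v \<in> frobenius_power I q"
    using ideal_act_closed[OF ideal] by simp
qed

text \<open>
  Let \<open>g\<close> be the gcd of the nonzero degrees. The degree \<open>j\<close> piece of \<open>R\<close> modulo the \<open>q\<close>-th Frobenius
  power is a line exactly when \<open>g\<close> divides \<open>j\<close> and \<open>j < q * h\<close>, and zero otherwise, up to a number
  of exceptional \<open>j\<close> that does not depend on \<open>q\<close>.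
\<close>

lemma frobenius_poincare_eq:
  assumes char: "CHAR('k) > 0" and hom: "is_homogeneous_ideal G I" and fin: "has_finite_colength I"
    and h: "h = (LEAST m. \<exists>x\<in>I. x \<noteq> 0 \<and> x \<in> G m)"
  shows "frobenius_poincare act G I y = of_real (hilbert_samuel_multiplicity act G) *
    (if y = 0 then of_nat h else (1 - exp (- \<i> * of_nat h * y)) / (\<i> * y))"
proof -
  obtain g c where g: "g > 0" and dvd: "\<And>j. G j \<noteq> {0} \<Longrightarrow> g dvd j"
    and eventually: "\<And>j. c \<le> j \<Longrightarrow> g dvd j \<Longrightarrow> G j \<noteq> {0}"
    using nonzero_degrees by (elim exE conjE) metis
  obtain x where x: "x \<in> I" "x \<noteq> 0" "x \<in> G h" and tail: "I \<subseteq> tail h"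
    using initial_degree[OF hom ideal_nonzero[OF fin] h] .
  define p where "p = CHAR('k)"
  define a where "a n j = the_enat (quotient_length act (frobenius_power I (p ^ n)) (G j))" for n j
  have ideal: "is_ideal (frobenius_power I q)" for q
    by (simp add: frobenius_power_def ideal.subspace_span)
  have a: "a n j = (if G j \<subseteq> frobenius_power I (p ^ n) then 0 else 1)" for n j
    by (simp add: a_def quotient_length_piece[OF ideal] zero_enat_def one_enat_def)
  have gh: "g dvd h" by (rule dvd) (use x in \<open>metis singletonD\<close>)
  have "p \<noteq> 1" "p > 0" using char by (simp_all add: p_def)
  then have p: "p > 1" by simp
  have "(\<lambda>n. 1 / of_nat (p ^ n) * (\<Sum>\<^sub>\<infinity>j. of_nat (a n j) * exp (- \<i> * y * of_nat j / of_nat (p ^ n))))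
    \<longlonglongrightarrow> 1 / of_nat g * (if y = 0 then of_nat h else (1 - exp (- \<i> * of_nat h * y)) / (\<i> * y))"
  proof (rule truncated_multiples_limit[where c = c])
    show "filterlim (\<lambda>n. p ^ n) at_top sequentially"
    proof (rule filterlim_at_top_mono[OF filterlim_ident])
      show "\<forall>\<^sub>F n in sequentially. n \<le> p ^ n"
        using p by (intro always_eventually allI less_imp_le power_gt_expt) simp
    qed
    show "a n j \<le> 1" for n j by (simp add: a)
    show "a n j = of_bool (g dvd j)" if "c \<le> j" "j < p ^ n * h" for n j
      using piece_below_frobenius_power[OF tail that(2)] dvd[of j] eventually[OF that(1)] by (auto simp: a)
    show "a n j = 0" if j: "p ^ n * h + c \<le> j" for n j
    proof -
      have "G j \<subseteq> frobenius_power I (p ^ n)"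
      proof (cases "g dvd j")
        case True
        then have "g dvd j - p ^ n * h" using gh by (intro dvd_diff_nat dvd_mult)
        then have "G (j - p ^ n * h) \<noteq> {0}" using j by (intro eventually) auto
        then show ?thesis using j by (intro piece_in_frobenius_power[OF x]) auto
      next
        case False
        then have "G j = {0}" using dvd by blast
        then show ?thesis using ideal.subspace_0[OF ideal] by simp
      qed
      then show ?thesis by (simp add: a)
    qed
  qed (use p g gh in auto)
  from limI[OF this] show ?thesis
    by (simp add: frobenius_poincare_def dim one_enat_def a_def p_def Let_def
        hilbert_samuel_multiplicity_eq[OF g dvd eventually])
qed

end

theorem proposition4p6:
  fixes act :: "'k::alg_closed_field \<Rightarrow> 'r::idom \<Rightarrow> 'r"
    and G :: "nat \<Rightarrow> 'r set"
    and I :: "'r set"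
    and h :: nat
    and y :: complex
  assumes "CHAR('k) > 0"
    and "nat_graded_algebra act G"
    and "finitely_generated_algebra act"
    and "krull_dim TYPE('r) = 1"
    and "is_homogeneous_ideal G I"
    and "has_finite_colength I"
    and "h = (LEAST m. \<exists>x\<in>I. x \<noteq> 0 \<and> x \<in> G m)"
  shows "frobenius_poincare act G I y =
    remove_sings (\<lambda>z. of_real (hilbert_samuel_multiplicity act G) *
      ((1 - exp (- \<i> * of_nat h * z)) / (\<i> * z))) y"
proof -
  interpret one_dimensional_graded_domain act G
    by (intro one_dimensional_graded_domain.intro graded_domain.intro
        one_dimensional_graded_domain_axioms.intro) (fact assms)+
  show ?thesis
    using frobenius_poincare_eq[OF assms(1,5-7)] by (simp only: remove_sings_exp_quotient)
qed

end
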